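(* Let $F$ be a finite forest without isolated vertices. Then the following are equivalent: (a) every connected component of $F$ is either a star or $2$-internally extendable; (b) every $2$-matching of $F$ extends to a perfect internal matching of $F$; (c) $F$ is strongly equistarable; (d) $F$ is equistarable; (e) $F$ is $P_5$-constrained.
   Context: A star is a graph isomorphic to $K_{1,n}$ for some $n\ge 1$. A matching is a set of pairwise disjoint edges; a $k$-matching is a matching with exactly $k$ edges. A matching $M$ extends to $M'$ if $M\subseteq M'$. A matching $M$ is a perfect internal matching if every vertex not covered by $M$ is a leaf (degree $1$ vertex). For $k\ge1$, a connected graph is $k$-internally extendable if it contains a $k$-matching and every $k$-matching extends to a perfect internal matching. For a vertex $v$, $E(v)$ denotes the set of edges incident with $v$ (the star rooted at $v$); a star $E(v)$ is maximal if it is not properly contained in another star $E(u)$. A graph $G=(V,E)$ without isolated vertices is equistarable if there is $\varphi:E\to\mathbb{R}_+$ such that for all $F\subseteq E$, $F$ is a maximal star iff $\sum_{e\in F}\varphi(e)=1$. With $\mathcal{S}^*(G)$ the set of maximal stars and $\mathcal{T}^*(G)$ the set of other nonempty edge subsets, $G$ (without isolated vertices) is strongly equistarable if for every $T\in\mathcal{T}^*(G)$ and every $\gamma\le1$ there is $\varphi:E\to\mathbb{R}_+$ with $\varphi(S)=1$ for all $S\in\mathcal{S}^*(G)$ and $\varphi(T)\ne\gamma$. A graph is $P_5$-constrained if the middle vertex of every (not necessarily induced) path on $5$ vertices in the graph has degree at least $3$. *)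

theory Defs
  imports Complex_Main
begin

record 'a graph =
  verts :: "'a set"
  edges :: "'a set set"

definition simple_graph :: "'a graph \<Rightarrow> bool" where
  "simple_graph G \<longleftrightarrow>
     (\<forall>e\<in>edges G. \<exists>u\<in>verts G. \<exists>v\<in>verts G. u \<noteq> v \<and> e = {u, v})"

definition edges_at :: "'a graph \<Rightarrow> 'a \<Rightarrow> 'a set set" where
  "edges_at G v = {e \<in> edges G. v \<in> e}"

definition graph_degree :: "'a graph \<Rightarrow> 'a \<Rightarrow> nat" where
  "graph_degree G v = card (edges_at G v)"

definition no_isolated_vertices :: "'a graph \<Rightarrow> bool" where
  "no_isolated_vertices G \<longleftrightarrow> (\<forall>v\<in>verts G. edges_at G v \<noteq> {})"

definition is_path :: "'a graph \<Rightarrow> 'a list \<Rightarrow> bool" where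
  "is_path G p \<longleftrightarrow> p \<noteq> [] \<and> distinct p \<and> set p \<subseteq> verts G
     \<and> successively (\<lambda>u v. {u, v} \<in> edges G) p"

definition is_cycle :: "'a graph \<Rightarrow> 'a list \<Rightarrow> bool" where
  "is_cycle G p \<longleftrightarrow> is_path G p \<and> length p \<ge> 3 \<and> {last p, hd p} \<in> edges G"

definition forest :: "'a graph \<Rightarrow> bool" where
  "forest G \<longleftrightarrow> simple_graph G \<and> (\<nexists>p. is_cycle G p)"

definition connected_rel :: "'a graph \<Rightarrow> ('a \<times> 'a) set" where
  "connected_rel G =
     {(u, v) \<in> verts G \<times> verts G. \<exists>p. is_path G p \<and> hd p = u \<and> last p = v}"

definition connected_graph :: "'a graph \<Rightarrow> bool" where
  "connected_graph G \<longleftrightarrow> verts G \<noteq> {} \<and> connected_rel G = verts G \<times> verts G"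

definition induced_subgraph :: "'a graph \<Rightarrow> 'a set \<Rightarrow> 'a graph" where
  "induced_subgraph G C = \<lparr>verts = C, edges = {e \<in> edges G. e \<subseteq> C}\<rparr>"

definition graph_components :: "'a graph \<Rightarrow> 'a graph set" where
  "graph_components G = induced_subgraph G ` (verts G // connected_rel G)"

definition graph_iso :: "'a graph \<Rightarrow> 'b graph \<Rightarrow> bool" where
  "graph_iso G H \<longleftrightarrow> (\<exists>f. bij_betw f (verts G) (verts H) \<and>
     (\<forall>u\<in>verts G. \<forall>v\<in>verts G. {u, v} \<in> edges G \<longleftrightarrow> {f u, f v} \<in> edges H))"

text \<open>The complete bipartite graph $K_{1,n}$, with centre \<open>0\<close> and leaves \<open>1, \<dots>, n\<close>.\<close>

definition K1 :: "nat \<Rightarrow> nat graph" where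
  "K1 n = \<lparr>verts = {0..n}, edges = {{0, i} | i. i \<in> {1..n}}\<rparr>"

definition is_star :: "'a graph \<Rightarrow> bool" where
  "is_star G \<longleftrightarrow> (\<exists>n\<ge>1. graph_iso G (K1 n))"

definition matching :: "'a graph \<Rightarrow> 'a set set \<Rightarrow> bool" where
  "matching G M \<longleftrightarrow> M \<subseteq> edges G \<and> pairwise disjnt M"

definition k_matching :: "'a graph \<Rightarrow> nat \<Rightarrow> 'a set set \<Rightarrow> bool" where
  "k_matching G k M \<longleftrightarrow> matching G M \<and> finite M \<and> card M = k"

definition perfect_internal_matching :: "'a graph \<Rightarrow> 'a set set \<Rightarrow> bool" where
  "perfect_internal_matching G M \<longleftrightarrow>
     matching G M \<and> (\<forall>v\<in>verts G. v \<notin> \<Union>M \<longrightarrow> graph_degree G v = 1)"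

definition every_k_matching_extends :: "'a graph \<Rightarrow> nat \<Rightarrow> bool" where
  "every_k_matching_extends G k \<longleftrightarrow>
     (\<forall>M. k_matching G k M \<longrightarrow> (\<exists>M'. perfect_internal_matching G M' \<and> M \<subseteq> M'))"

definition internally_extendable :: "nat \<Rightarrow> 'a graph \<Rightarrow> bool" where
  "internally_extendable k G \<longleftrightarrow>
     connected_graph G \<and> (\<exists>M. k_matching G k M) \<and> every_k_matching_extends G k"

definition maximal_stars :: "'a graph \<Rightarrow> 'a set set set" where
  "maximal_stars G =
     {edges_at G v | v. v \<in> verts G \<and> \<not> (\<exists>u\<in>verts G. edges_at G v \<subset> edges_at G u)}"

definition nonmaximal_sets :: "'a graph \<Rightarrow> 'a set set set" where
  "nonmaximal_sets G = {T. T \<subseteq> edges G \<and> T \<noteq> {} \<and> T \<notin> maximal_stars G}"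

text \<open>
  Weights take values in the nonnegative reals. For finite graphs, asking for positive weights
  in the next two definitions would give the same classes of graphs.
\<close>

definition equistarable :: "'a graph \<Rightarrow> bool" where
  "equistarable G \<longleftrightarrow> no_isolated_vertices G \<and>
     (\<exists>\<phi> :: 'a set \<Rightarrow> real. (\<forall>e\<in>edges G. \<phi> e \<ge> 0) \<and>
        (\<forall>F\<subseteq>edges G. F \<in> maximal_stars G \<longleftrightarrow> (\<Sum>e\<in>F. \<phi> e) = 1))"

definition strongly_equistarable :: "'a graph \<Rightarrow> bool" where
  "strongly_equistarable G \<longleftrightarrow> no_isolated_vertices G \<and>
     (\<forall>T\<in>nonmaximal_sets G. \<forall>\<gamma>::real. \<gamma> \<le> 1 \<longrightarrow>
        (\<exists>\<phi> :: 'a set \<Rightarrow> real. (\<forall>e\<in>edges G. \<phi> e \<ge> 0) \<and>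
           (\<forall>S\<in>maximal_stars G. (\<Sum>e\<in>S. \<phi> e) = 1) \<and> (\<Sum>e\<in>T. \<phi> e) \<noteq> \<gamma>))"

definition P5_constrained :: "'a graph \<Rightarrow> bool" where
  "P5_constrained G \<longleftrightarrow>
     (\<forall>p. is_path G p \<and> length p = 5 \<longrightarrow> graph_degree G (p ! 2) \<ge> 3)"

end

theory Submission imports Defs begin

text \<open>
  Every condition is compared with the last one. If \<open>a', a, v, b, b'\<close> is a path and \<open>v\<close> has degree 2,
  then no matching containing \<open>a'a\<close> and \<open>bb'\<close> covers \<open>v\<close>, and \<open>(E(a) - av) \<union> (E(b) - vb)\<close> is forced
  to have weight \<open>1 + 1 - 1\<close> although it is not a star. Conversely, in a P5-constrained forest two
  disjoint edges in the same component are the end edges of a path whose remaining inner vertices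
  have degree at least 3, hence a neighbour off the path; matching them there and continuing outwards
  from the path gives a perfect internal matching. Indicator functions of such matchings are the
  weights for strong equistarability, and a generic convex combination of them is an equistarable
  weight. Condition (a) follows by applying the extension argument to each component.
\<close>

section \<open>Forests\<close>

definition nbrs :: "'a graph \<Rightarrow> 'a \<Rightarrow> 'a set" where
  "nbrs G v = {w. {v, w} \<in> edges G}"

text \<open>Connectivity inside a vertex set is handled through the reflexive transitive closure of
  this relation, which is symmetric and composes freely. Paths as lists are recovered from it only
  where a cycle or an extremal path is wanted.\<close>

definition adj :: "'a graph \<Rightarrow> 'a set \<Rightarrow> ('a \<times> 'a) set" where
  "adj G R = {(u, v). u \<in> R \<and> v \<in> R \<and> {u, v} \<in> edges G}"

lemma edge_verts:
  assumes "simple_graph G" "{u, v} \<in> edges G"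
  shows "u \<in> verts G" "v \<in> verts G" "u \<noteq> v"
  using assms unfolding simple_graph_def by (fastforce simp: doubleton_eq_iff)+

lemma edge_cases:
  assumes "simple_graph G" "e \<in> edges G"
  obtains u v where "e = {u, v}" "u \<noteq> v" "u \<in> verts G" "v \<in> verts G"
  using assms unfolding simple_graph_def by blast

lemma edge_cases_at:
  assumes "simple_graph G" "e \<in> edges G" "u \<in> e"
  obtains v where "e = {u, v}" "u \<noteq> v" "v \<in> verts G"
proof -
  obtain a b where ab: "e = {a, b}" "a \<noteq> b" "a \<in> verts G" "b \<in> verts G"
    using edge_cases[OF assms(1,2)] .
  show ?thesis
  proof (cases "u = a")
    case True
    then show ?thesis using that[of b] ab by simp
  next
    case False
    then show ?thesis using that[of a] ab assms(3) by (auto simp: insert_commute)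
  qed
qed

lemma edges_at_eq_image:
  assumes "simple_graph G"
  shows "edges_at G v = (\<lambda>w. {v, w}) ` nbrs G v"
proof -
  have "e \<in> (\<lambda>w. {v, w}) ` nbrs G v" if "e \<in> edges_at G v" for e
  proof -
    from that have e: "e \<in> edges G" "v \<in> e" by (auto simp: edges_at_def)
    obtain w where "e = {v, w}" using edge_cases_at[OF assms e] by blast
    with e show ?thesis by (auto simp: nbrs_def)
  qed
  then show ?thesis by (auto simp: edges_at_def nbrs_def)
qed

lemma graph_degree_eq_card_nbrs:
  assumes "simple_graph G"
  shows "graph_degree G v = card (nbrs G v)"
proof -
  have "inj_on (\<lambda>w. {v, w}) (nbrs G v)" by (auto simp: inj_on_def doubleton_eq_iff)
  then show ?thesis
    by (simp add: graph_degree_def edges_at_eq_image[OF assms] card_image)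
qed

lemma finite_edges:
  assumes "finite (verts G)" "simple_graph G"
  shows "finite (edges G)"
proof -
  have "edges G \<subseteq> Pow (verts G)" using assms(2) unfolding simple_graph_def by fastforce
  with assms(1) show ?thesis by (meson finite_Pow_iff finite_subset)
qed

lemma finite_edges_at:
  assumes "finite (verts G)" "simple_graph G"
  shows "finite (edges_at G v)"
  using finite_edges[OF assms] by (simp add: edges_at_def)

lemma finite_nbrs:
  assumes "finite (verts G)" "simple_graph G"
  shows "finite (nbrs G v)"
proof -
  have "nbrs G v \<subseteq> verts G" using edge_verts[OF assms(2)] by (auto simp: nbrs_def)
  with assms(1) show ?thesis by (rule finite_subset[rotated])
qed

lemma degree_ne_1_two_nbrs:
  assumes "finite (verts G)" "simple_graph G" "no_isolated_vertices G" "v \<in> verts G"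
    "graph_degree G v \<noteq> 1"
  obtains x y where "x \<noteq> y" "{v, x} \<in> edges G" "{v, y} \<in> edges G"
proof -
  have "edges_at G v \<noteq> {}" using assms(3,4) by (auto simp: no_isolated_vertices_def)
  then obtain x where x: "x \<in> nbrs G v" by (auto simp: edges_at_eq_image[OF assms(2)])
  have "nbrs G v \<noteq> {x}" using assms(5) by (auto simp: graph_degree_eq_card_nbrs[OF assms(2)])
  with x obtain y where "y \<in> nbrs G v" "y \<noteq> x" by blast
  with x show ?thesis using that by (auto simp: nbrs_def)
qed

lemma no_triangle:
  assumes "forest G" "{x, y} \<in> edges G" "{y, z} \<in> edges G" "{z, x} \<in> edges G"
  shows False
proof -
  have sg: "simple_graph G" using assms(1) by (simp add: forest_def)
  have "is_cycle G [x, y, z]"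
    using edge_verts[OF sg assms(2)] edge_verts[OF sg assms(3)] edge_verts[OF sg assms(4)] assms
    by (auto simp: is_cycle_def is_path_def)
  then show False using assms(1) by (auto simp: forest_def)
qed

text \<open>A pairwise intersecting family of edges either has a common vertex or contains a
  triangle, and a forest has no triangle.\<close>

lemma intersecting_edges_in_star:
  assumes fo: "forest G" and T: "T \<subseteq> edges G" "T \<noteq> {}"
    and int: "\<And>e f. e \<in> T \<Longrightarrow> f \<in> T \<Longrightarrow> \<not> disjnt e f"
  obtains v where "v \<in> verts G" "T \<subseteq> edges_at G v"
proof -
  have sg: "simple_graph G" using fo by (simp add: forest_def)
  obtain e where e: "e \<in> T" using T by blast
  with T obtain x y where xy: "e = {x, y}" "x \<noteq> y" "x \<in> verts G" "y \<in> verts G"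
    using edge_cases[OF sg] by blast
  have "(\<forall>f\<in>T. x \<in> f) \<or> (\<forall>f\<in>T. y \<in> f)"
  proof (rule ccontr)
    assume "\<not> ?thesis"
    then obtain f g where f: "f \<in> T" "x \<notin> f" and g: "g \<in> T" "y \<notin> g" by blast
    have "y \<in> f" "x \<in> g" using int[OF e f(1)] int[OF e g(1)] f g xy by (auto simp: disjnt_def)
    obtain z where z: "f = {y, z}" using edge_cases_at[OF sg _ \<open>y \<in> f\<close>] f(1) T by blast
    obtain w where w: "g = {x, w}" using edge_cases_at[OF sg _ \<open>x \<in> g\<close>] g(1) T by blast
    \<comment> \<open>\<open>f\<close> avoids \<open>x\<close> and \<open>g\<close> avoids
      \<open>y\<close>, so they can only meet in a third vertex, which closes a triangle on
      \<open>x\<close> and \<open>y\<close>.\<close>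
    have "z = w" using int[OF f(1) g(1)] f(2) g(2) z w by (auto simp: disjnt_def)
    then show False
      using no_triangle[OF fo, of x y z] e f(1) g(1) T xy(1) z w by (auto simp: insert_commute)
  qed
  then show ?thesis using that T xy by (auto simp: edges_at_def)
qed

section \<open>Paths and connectivity\<close>

lemma adj_mono: "R \<subseteq> S \<Longrightarrow> adj G R \<subseteq> adj G S"
  by (auto simp: adj_def)

lemma rtrancl_adj_mono: "(x, y) \<in> (adj G R)\<^sup>* \<Longrightarrow> R \<subseteq> S \<Longrightarrow> (x, y) \<in> (adj G S)\<^sup>*"
  using rtrancl_mono[OF adj_mono] by blast

lemma rtrancl_adj_sym: "(x, y) \<in> (adj G R)\<^sup>* \<Longrightarrow> (y, x) \<in> (adj G R)\<^sup>*"
  by (rule symD[OF sym_rtrancl]) (auto simp: adj_def sym_def insert_commute)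

lemma rtrancl_adj_imp_path:
  assumes "(x, y) \<in> (adj G R)\<^sup>*" "x \<in> R" "R \<subseteq> verts G"
  shows "\<exists>p. is_path G p \<and> set p \<subseteq> R \<and> hd p = x \<and> last p = y"
  using assms(1)
proof (induction rule: rtrancl_induct)
  case base
  show ?case by (rule exI[of _ "[x]"]) (use assms in \<open>auto simp: is_path_def\<close>)
next
  case (step y z)
  then obtain p where p: "is_path G p" "set p \<subseteq> R" "hd p = x" "last p = y" by blast
  have z: "z \<in> R" "{y, z} \<in> edges G" using step.hyps by (auto simp: adj_def)
  show ?case
  proof (cases "z \<in> set p")
    case True
    \<comment> \<open>The walk has come back to a vertex already visited, so the path is cut off
      there.\<close>
    then obtain as bs where ab: "p = as @ z # bs" by (meson split_list)
    have "is_path G (as @ [z])" "set (as @ [z]) \<subseteq> R" "hd (as @ [z]) = x"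
      using p unfolding ab is_path_def
      by (auto simp: successively_append_iff hd_append)
    then show ?thesis by (metis last_snoc)
  next
    case False
    have "is_path G (p @ [z])"
      using p z False assms(3) by (auto simp: is_path_def successively_append_iff)
    then show ?thesis using p z by (intro exI[of _ "p @ [z]"]) (auto simp: is_path_def)
  qed
qed

lemma successively_rtrancl_adj:
  assumes "successively (\<lambda>u v. {u, v} \<in> edges G) p" "set p \<subseteq> R" "y \<in> set p"
  shows "(hd p, y) \<in> (adj G R)\<^sup>*"
  using assms
proof (induction p)
  case (Cons x xs)
  show ?case
  proof (cases "y = x")
    case False
    with Cons.prems have y: "y \<in> set xs" by simp
    then have "xs \<noteq> []" by auto
    with Cons.prems have "(x, hd xs) \<in> adj G R" "successively (\<lambda>u v. {u, v} \<in> edges G) xs"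
      by (auto simp: adj_def successively_Cons)
    with Cons y show ?thesis by (auto intro: converse_rtrancl_into_rtrancl)
  qed simp
qed simp

lemma path_connected_set:
  assumes "is_path G p" "x \<in> set p" "y \<in> set p" "set p \<subseteq> R"
  shows "(x, y) \<in> (adj G R)\<^sup>*"
proof -
  have "(hd p, x) \<in> (adj G R)\<^sup>*" "(hd p, y) \<in> (adj G R)\<^sup>*"
    using assms by (auto simp: is_path_def intro: successively_rtrancl_adj)
  then show ?thesis using rtrancl_adj_sym rtrancl_trans by metis
qed

lemma connected_rel_eq:
  "connected_rel G = {(u, v) \<in> verts G \<times> verts G. (u, v) \<in> (adj G (verts G))\<^sup>*}"
proof -
  have "(u, v) \<in> (adj G (verts G))\<^sup>*" if "is_path G p" "hd p = u" "last p = v" for p u v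
    using path_connected_set[OF that(1), of u v "verts G"] that by (auto simp: is_path_def)
  moreover have "\<exists>p. is_path G p \<and> hd p = u \<and> last p = v"
    if "(u, v) \<in> (adj G (verts G))\<^sup>*" "u \<in> verts G" for u v
    using rtrancl_adj_imp_path[OF that] by auto
  ultimately show ?thesis unfolding connected_rel_def by blast
qed

lemma is_path_segment: "is_path G (xs @ ys @ zs) \<Longrightarrow> ys \<noteq> [] \<Longrightarrow> is_path G ys"
  by (auto simp: is_path_def successively_append_iff)

lemma is_path_take_drop:
  assumes "is_path G p" "m < length p" "k > 0"
  shows "is_path G (take k (drop m p))"
proof (rule is_path_segment)
  show "is_path G (take m p @ take k (drop m p) @ drop k (drop m p))"
    using assms by (simp del: drop_drop)
qed (use assms in auto)

text \<open>A chord of a path closes the segment between its ends to a cycle, so in a forest only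
  consecutive vertices of a path are adjacent.\<close>

lemma path_edge_in_forest:
  assumes fo: "forest G" and p: "is_path G p" and ij: "i < j" "j < length p"
    and e: "{p ! i, p ! j} \<in> edges G"
  shows "j = Suc i"
proof (rule ccontr)
  assume "j \<noteq> Suc i"
  with ij have ij2: "j \<ge> i + 2" by simp
  define c where "c = take (j - i + 1) (drop i p)"
  have len: "length c = j - i + 1" using ij by (simp add: c_def)
  have "is_path G c" unfolding c_def using p ij by (intro is_path_take_drop) auto
  moreover have "hd c = p ! i" using ij by (simp add: c_def hd_drop_conv_nth)
  moreover have "last c = p ! j"
  proof -
    have "c \<noteq> []" using len by auto
    then have "last c = c ! (j - i)" using len by (simp add: last_conv_nth)
    also have "\<dots> = p ! j" using ij by (simp add: c_def)
    finally show ?thesis .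
  qed
  ultimately have "is_cycle G c" using len ij2 e by (simp add: is_cycle_def insert_commute)
  then show False using fo by (auto simp: forest_def)
qed

section \<open>Extending matchings greedily\<close>

text \<open>\<open>R\<close> meets each component of \<open>G\<close> in a connected set, possibly
  an empty one. Connectedness of \<open>R\<close> itself would be too strong, since a matching may
  start in two components and must finally reach all of them.\<close>

definition relatively_connected :: "'a graph \<Rightarrow> 'a set \<Rightarrow> bool" where
  "relatively_connected G R \<longleftrightarrow> R \<subseteq> verts G \<and>
     (\<forall>x\<in>R. \<forall>y\<in>R. (x, y) \<in> (adj G (verts G))\<^sup>* \<longrightarrow> (x, y) \<in> (adj G R)\<^sup>*)"

text \<open>Two neighbours of \<open>w\<close> lie in the same component of \<open>G\<close>, hence
  a path inside \<open>R\<close> joins them. Together with \<open>w\<close> outside of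
  \<open>R\<close> it would form a cycle.\<close>

lemma relatively_connected_unique_nbr:
  assumes fo: "forest G" and rc: "relatively_connected G R" and w: "w \<notin> R"
    and xy: "x \<in> R" "y \<in> R" "{w, x} \<in> edges G" "{w, y} \<in> edges G"
  shows "x = y"
proof (rule ccontr)
  assume ne: "x \<noteq> y"
  have sg: "simple_graph G" using fo by (simp add: forest_def)
  note v = edge_verts[OF sg xy(3)] edge_verts[OF sg xy(4)]
  have "(x, w) \<in> adj G (verts G)" "(w, y) \<in> adj G (verts G)"
    using xy v by (auto simp: adj_def insert_commute)
  then have "(x, y) \<in> (adj G (verts G))\<^sup>*" by (meson r_into_rtrancl rtrancl_trans)
  with rc xy have "(x, y) \<in> (adj G R)\<^sup>*" by (auto simp: relatively_connected_def)
  then obtain p where p: "is_path G p" "set p \<subseteq> R" "hd p = x" "last p = y"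
    using rtrancl_adj_imp_path xy rc unfolding relatively_connected_def by metis
  have "length p \<noteq> 1" using ne p by (auto simp: length_Suc_conv)
  moreover have "p \<noteq> []" using p by (simp add: is_path_def)
  then have "length p \<noteq> 0" by simp
  ultimately have "length p \<ge> 2" by linarith
  moreover have "is_path G (p @ [w])"
    using p w v xy by (auto simp: is_path_def successively_append_iff insert_commute)
  ultimately have "is_cycle G (p @ [w])"
    using p xy \<open>p \<noteq> []\<close> by (simp add: is_cycle_def)
  then show False using fo by (auto simp: forest_def)
qed

text \<open>Every vertex of the enlarged set is linked inside it to a vertex of \<open>R\<close>, so
  connections can be routed through \<open>R\<close>.\<close>

lemma relatively_connected_insert_adjacent:
  assumes rc: "relatively_connected G R" and v: "v \<in> verts G" "x \<in> R" "{x, v} \<in> edges G"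
  shows "relatively_connected G (insert v R)"
proof -
  let ?R = "insert v R"
  have sub: "?R \<subseteq> verts G" using rc v by (auto simp: relatively_connected_def)
  have ex: "\<exists>a'\<in>R. (a, a') \<in> (adj G ?R)\<^sup>*" if "a \<in> ?R" for a
  proof (cases "a \<in> R")
    case False
    with that have "(a, x) \<in> adj G ?R" using v by (auto simp: adj_def insert_commute)
    then show ?thesis using v by blast
  qed blast
  have "(a, b) \<in> (adj G ?R)\<^sup>*"
    if ab: "a \<in> ?R" "b \<in> ?R" "(a, b) \<in> (adj G (verts G))\<^sup>*" for a b
  proof -
    obtain a' where a': "a' \<in> R" "(a, a') \<in> (adj G ?R)\<^sup>*" using ex ab by blast
    obtain b' where b': "b' \<in> R" "(b, b') \<in> (adj G ?R)\<^sup>*" using ex ab by blast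
    have "(a', b') \<in> (adj G (verts G))\<^sup>*"
      using rtrancl_adj_mono[OF a'(2) sub] rtrancl_adj_mono[OF b'(2) sub] ab(3)
      by (meson rtrancl_adj_sym rtrancl_trans)
    then have "(a', b') \<in> (adj G R)\<^sup>*" using rc a' b' by (auto simp: relatively_connected_def)
    then have "(a', b') \<in> (adj G ?R)\<^sup>*" by (rule rtrancl_adj_mono) blast
    then show ?thesis using a' b' by (meson rtrancl_adj_sym rtrancl_trans)
  qed
  with sub show ?thesis by (auto simp: relatively_connected_def)
qed

lemma rtrancl_adj_closed:
  assumes "(x, y) \<in> (adj G S)\<^sup>*" "x \<in> R"
    and "\<And>u w. u \<in> R \<Longrightarrow> {u, w} \<in> edges G \<Longrightarrow> w \<in> R"
  shows "y \<in> R"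
  using assms(1,2) by (induction rule: rtrancl_induct) (use assms(3) in \<open>auto simp: adj_def\<close>)

text \<open>As no edge leaves \<open>R\<close>, the set is a union of components, and
  \<open>v\<close> lies in a component that \<open>R\<close> does not meet.\<close>

lemma relatively_connected_insert_separate:
  assumes rc: "relatively_connected G R" and v: "v \<in> verts G" "v \<notin> R"
    and closed: "\<And>u w. u \<in> R \<Longrightarrow> {u, w} \<in> edges G \<Longrightarrow> w \<in> R"
  shows "relatively_connected G (insert v R)"
proof -
  let ?R = "insert v R"
  have no: "(b, v) \<notin> (adj G (verts G))\<^sup>*" "(v, b) \<notin> (adj G (verts G))\<^sup>*" if "b \<in> R" for b
    using rtrancl_adj_closed[of b v G "verts G" R] that closed v(2)
      rtrancl_adj_sym[of v b G "verts G"] by blast+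
  have "(a, b) \<in> (adj G ?R)\<^sup>*"
    if ab: "a \<in> ?R" "b \<in> ?R" "(a, b) \<in> (adj G (verts G))\<^sup>*" for a b
  proof (cases "a = b")
    case False
    with ab no have "a \<in> R" "b \<in> R" by auto
    then have "(a, b) \<in> (adj G R)\<^sup>*" using rc ab by (auto simp: relatively_connected_def)
    then show ?thesis by (rule rtrancl_adj_mono) blast
  qed simp
  then show ?thesis using rc v by (auto simp: relatively_connected_def)
qed

text \<open>An uncovered inner vertex of \<open>R\<close> can be matched to its neighbour outside of \<open>R\<close> without
  blocking another one, because a vertex outside of \<open>R\<close> has at most one neighbour in \<open>R\<close>.\<close>

lemma matching_extends_greedily:
  assumes fin: "finite (verts G)" and fo: "forest G" and ni: "no_isolated_vertices G"
    and "matching G M" "\<Union>M \<subseteq> R" "relatively_connected G R"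
    and "\<And>v. v \<in> R \<Longrightarrow> v \<notin> \<Union>M \<Longrightarrow> graph_degree G v = 1 \<or> (\<exists>w. w \<notin> R \<and> {v, w} \<in> edges G)"
  shows "\<exists>M'. perfect_internal_matching G M' \<and> M \<subseteq> M'"
  using assms(4-)
proof (induction "card (verts G - R)" arbitrary: M R rule: less_induct)
  case less
  note M = \<open>matching G M\<close> and MR = \<open>\<Union>M \<subseteq> R\<close> and rc = \<open>relatively_connected G R\<close>
  note free = less.prems(4)
  have sg: "simple_graph G" using fo by (simp add: forest_def)
  have Rsub: "R \<subseteq> verts G" using rc by (simp add: relatively_connected_def)
  have dec: "card (verts G - insert v R) < card (verts G - R)" if "v \<in> verts G" "v \<notin> R" for v
    using fin that by (intro psubset_card_mono) auto
  consider (pending) v where "v \<in> R" "v \<notin> \<Union>M" "graph_degree G v \<noteq> 1"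
    | (all) "\<And>v. v \<in> R \<Longrightarrow> v \<notin> \<Union>M \<Longrightarrow> graph_degree G v = 1" by blast
  then show ?case
  proof cases
    case pending
    then obtain w where w: "w \<notin> R" "{v, w} \<in> edges G" using free by blast
    have wv: "w \<in> verts G" using edge_verts[OF sg w(2)] by simp
    let ?M = "insert {v, w} M"
    have "\<exists>M'. perfect_internal_matching G M' \<and> ?M \<subseteq> M'"
    proof (rule less.hyps[OF dec[OF wv w(1)]])
      show "matching G ?M"
        using M w MR pending by (auto simp: matching_def pairwise_insert disjnt_def)
      show "\<Union>?M \<subseteq> insert w R" using MR pending by auto
      show "relatively_connected G (insert w R)"
        using rc wv pending(1) w(2) by (rule relatively_connected_insert_adjacent)
      fix u assume u: "u \<in> insert w R" "u \<notin> \<Union>?M"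
      then have uR: "u \<in> R" "u \<notin> \<Union>M" "u \<noteq> v" by auto
      show "graph_degree G u = 1 \<or> (\<exists>z. z \<notin> insert w R \<and> {u, z} \<in> edges G)"
      proof (cases "graph_degree G u = 1")
        case False
        then obtain z where z: "z \<notin> R" "{u, z} \<in> edges G" using free uR by blast
        \<comment> \<open>The only neighbour of \<open>w\<close> in \<open>R\<close> is
          \<open>v\<close>, so using up \<open>w\<close> does not take away the free neighbour of
          another waiting vertex \<open>u\<close>.\<close>
        have "z \<noteq> w"
          using relatively_connected_unique_nbr[OF fo rc w(1), of u v] uR pending(1) z w
          by (auto simp: insert_commute)
        with z show ?thesis by blast
      qed simp
    qed
    then show ?thesis by blast
  next
    case all
    show ?thesis
    proof (cases "R = verts G")
      case True
      then show ?thesis using M all by (auto simp: perfect_internal_matching_def)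
    next
      case False
      \<comment> \<open>With nothing left to match inside \<open>R\<close>, one uncovered vertex is
        added. It is chosen adjacent to \<open>R\<close> whenever some edge leaves \<open>R\<close>,
        which keeps \<open>R\<close> relatively connected.\<close>
      have "\<exists>v. v \<in> verts G \<and> v \<notin> R \<and> relatively_connected G (insert v R)"
      proof (cases "\<exists>v x. v \<notin> R \<and> x \<in> R \<and> {x, v} \<in> edges G")
        case True
        then obtain v x where vx: "v \<notin> R" "x \<in> R" "{x, v} \<in> edges G" by blast
        then have "v \<in> verts G" using edge_verts[OF sg] by blast
        with vx rc show ?thesis using relatively_connected_insert_adjacent by metis
      next
        case closed: False
        obtain v where "v \<in> verts G" "v \<notin> R" using False Rsub by blast
        with rc closed show ?thesis using relatively_connected_insert_separate by metis
      qed
      then obtain v where v: "v \<in> verts G" "v \<notin> R" "relatively_connected G (insert v R)" by blast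
      show ?thesis
      proof (rule less.hyps[OF dec[OF v(1,2)] M _ v(3)])
        show "\<Union>M \<subseteq> insert v R" using MR by blast
        fix u assume u: "u \<in> insert v R" "u \<notin> \<Union>M"
        show "graph_degree G u = 1 \<or> (\<exists>w. w \<notin> insert v R \<and> {u, w} \<in> edges G)"
        proof (cases "u = v \<and> graph_degree G v \<noteq> 1")
          case True
          then obtain x y where xy: "x \<noteq> y" "{v, x} \<in> edges G" "{v, y} \<in> edges G"
            using degree_ne_1_two_nbrs[OF fin sg ni v(1)] by blast
          \<comment> \<open>At most one neighbour of \<open>v\<close> lies in \<open>R\<close>, so
            an inner vertex \<open>v\<close> still has a partner available outside.\<close>
          then have "x \<notin> R \<or> y \<notin> R"
            using relatively_connected_unique_nbr[OF fo rc v(2)] by blast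
          moreover have "x \<noteq> v" "y \<noteq> v" using edge_verts(3)[OF sg] xy by blast+
          ultimately show ?thesis using True xy by blast
        qed (use u all in auto)
      qed
    qed
  qed
qed

section \<open>Extending 2-matchings in P5-constrained forests\<close>

text \<open>The greedy extension starts from the vertex set of the whole path. A vertex of
  \<open>xs\<close> is the middle of five consecutive path vertices, so it has at least three
  neighbours, of which at most two are on the path.\<close>

lemma P5_constrained_extend_along_path:
  assumes fin: "finite (verts G)" and fo: "forest G" and ni: "no_isolated_vertices G"
    and P5: "P5_constrained G" and q: "is_path G (a # b # xs @ [c, d])"
  shows "\<exists>M'. perfect_internal_matching G M' \<and> {{a, b}, {c, d}} \<subseteq> M'"
proof -
  define q where "q = a # b # xs @ [c, d]"
  have pq: "is_path G q" using assms(5) by (simp add: q_def)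
  have sg: "simple_graph G" using fo by (simp add: forest_def)
  have dq: "distinct q" using pq by (simp add: is_path_def)
  show ?thesis
  proof (rule matching_extends_greedily[OF fin fo ni, where R = "set q"])
    show "matching G {{a, b}, {c, d}}"
      using pq by (auto simp: q_def matching_def is_path_def pairwise_insert disjnt_def
          successively_Cons successively_append_iff)
    show "\<Union>{{a, b}, {c, d}} \<subseteq> set q" by (auto simp: q_def)
    show "relatively_connected G (set q)"
      using pq path_connected_set[OF pq] by (auto simp: relatively_connected_def is_path_def)
    fix v assume v: "v \<in> set q" "v \<notin> \<Union>{{a, b}, {c, d}}"
    then have "v \<in> set xs" by (auto simp: q_def)
    then obtain k where k: "k < length xs" "xs ! k = v" by (auto simp: in_set_conv_nth)
    let ?i = "k + 2"
    have lq: "length q = length xs + 4" by (simp add: q_def)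
    have qi: "q ! ?i = v" using k by (simp add: q_def nth_append)
    \<comment> \<open>The vertex \<open>xs ! k\<close> sits at position \<open>k + 2\<close> of
      \<open>q\<close>, so the window of five vertices starting at \<open>k\<close> is centred at
      it.\<close>
    have "is_path G (take 5 (drop k q))" using pq k lq by (intro is_path_take_drop) auto
    moreover have "length (take 5 (drop k q)) = 5" using k lq by simp
    moreover have "take 5 (drop k q) ! 2 = v" using qi k lq by (simp add: add.commute)
    ultimately have "graph_degree G v \<ge> 3" using P5 unfolding P5_constrained_def by metis
    then have c3: "card (nbrs G v) \<ge> 3" by (simp add: graph_degree_eq_card_nbrs[OF sg])
    have "nbrs G v \<inter> set q \<subseteq> {q ! (k + 1), q ! (k + 3)}"
    proof
      fix w assume w: "w \<in> nbrs G v \<inter> set q"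
      then obtain j where j: "j < length q" "q ! j = w" by (auto simp: in_set_conv_nth)
      have e: "{q ! ?i, q ! j} \<in> edges G" using w j qi by (simp add: nbrs_def)
      have "j \<noteq> ?i" using edge_verts(3)[OF sg e] by auto
      then consider "j < ?i" | "?i < j" by linarith
      then have "j = k + 1 \<or> j = k + 3"
      proof cases
        case 1
        then have "?i = Suc j"
          using path_edge_in_forest[OF fo pq, of j ?i] e k lq by (auto simp: insert_commute)
        then show ?thesis by simp
      next
        case 2
        then show ?thesis using path_edge_in_forest[OF fo pq, of ?i j] e j by auto
      qed
      with j show "w \<in> {q ! (k + 1), q ! (k + 3)}" by auto
    qed
    then have "card (nbrs G v \<inter> set q) \<le> card {q ! (k + 1), q ! (k + 3)}"
      by (intro card_mono) auto
    also have "\<dots> \<le> 2" by (simp add: card_insert_if)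
    finally have "nbrs G v \<inter> set q \<noteq> nbrs G v" using c3 by auto
    then show "graph_degree G v = 1 \<or> (\<exists>w. w \<notin> set q \<and> {v, w} \<in> edges G)"
      by (auto simp: nbrs_def)
  qed
qed

text \<open>Among all paths from an end of \<open>e\<close> to an end of \<open>f\<close> take a
  shortest one. The other ends of \<open>e\<close> and \<open>f\<close> are not on it, since
  otherwise it could be shortened, and so they can be attached to its two ends.\<close>

lemma connecting_path_with_end_edges:
  assumes sg: "simple_graph G" and e: "e \<in> edges G" "f \<in> edges G" "disjnt e f"
    and conn: "x \<in> e" "y \<in> f" "(x, y) \<in> (adj G (verts G))\<^sup>*"
  obtains a b c d xs where "is_path G (a # b # xs @ [c, d])" "e = {a, b}" "f = {c, d}"
proof -
  let ?P = "\<lambda>p. is_path G p \<and> hd p \<in> e \<and> last p \<in> f"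
  have "x \<in> verts G" using edge_cases[OF sg e(1)] conn(1) by blast
  then obtain p0 where "?P p0" using rtrancl_adj_imp_path[OF conn(3)] conn by blast
  from ex_has_least_nat[of ?P, OF this, of length]
  obtain p where p: "?P p" and min: "\<And>q. ?P q \<Longrightarrow> length p \<le> length q" by blast
  obtain a where a: "e = {hd p, a}" "hd p \<noteq> a" "a \<in> verts G"
    using edge_cases_at[OF sg e(1), of "hd p"] p by blast
  obtain d where d: "f = {last p, d}" "last p \<noteq> d" "d \<in> verts G"
    using edge_cases_at[OF sg e(2), of "last p"] p by blast
  have "a \<notin> set p"
  proof
    assume "a \<in> set p"
    then obtain as bs where s: "p = as @ a # bs" by (meson split_list)
    have "as \<noteq> []" using a s by auto
    moreover have "?P (a # bs)"
      using p a is_path_segment[of G as "a # bs" "[]"] by (auto simp: s)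
    ultimately show False using min[of "a # bs"] s by auto
  qed
  have "d \<notin> set p"
  proof
    assume "d \<in> set p"
    then obtain as bs where s: "p = as @ d # bs" by (meson split_list)
    have "bs \<noteq> []" using d s by auto
    moreover have "?P (as @ [d])"
      using p d is_path_segment[of G "[]" "as @ [d]" bs] by (auto simp: s hd_append)
    ultimately show False using min[of "as @ [d]"] s by auto
  qed
  have ad: "a \<noteq> d" "hd p \<noteq> last p" using e(3) a d by (auto simp: disjnt_def)
  have "p \<noteq> []" using p by (simp add: is_path_def)
  then obtain b ys where p1: "p = b # ys" by (cases p) auto
  with ad have "ys \<noteq> []" by auto
  then obtain xs c where p2: "ys = xs @ [c]" by (cases ys rule: rev_cases) auto
  have "is_path G (a # p @ [d])"
    using p a d \<open>a \<notin> set p\<close> \<open>d \<notin> set p\<close> ad e \<open>p \<noteq> []\<close>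
    by (auto simp: is_path_def successively_Cons successively_append_iff insert_commute)
  then have "is_path G (a # b # xs @ [c, d])" by (simp add: p1 p2)
  moreover have "e = {a, b}" "f = {c, d}" using a d p1 p2 by auto
  ultimately show ?thesis by (rule that)
qed

text \<open>Two disjoint edges of one component are the end edges of a path. If they lie in
  different components, the four end vertices already form a relatively connected set without
  uncovered vertices, and the greedy extension starts there.\<close>

lemma P5_constrained_imp_extends:
  assumes fin: "finite (verts G)" and fo: "forest G" and ni: "no_isolated_vertices G"
    and P5: "P5_constrained G"
  shows "every_k_matching_extends G 2"
  unfolding every_k_matching_extends_def
proof (intro allI impI)
  fix M assume M2: "k_matching G 2 M"
  have sg: "simple_graph G" using fo by (simp add: forest_def)
  from M2 have M: "matching G M" and "card M = 2" by (auto simp: k_matching_def)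
  then obtain e f where ef: "M = {e, f}" "e \<noteq> f" by (auto simp: card_2_iff)
  with M have e: "e \<in> edges G" "f \<in> edges G" "disjnt e f"
    by (auto simp: matching_def pairwise_insert)
  show "\<exists>M'. perfect_internal_matching G M' \<and> M \<subseteq> M'"
  proof (cases "\<exists>x\<in>e. \<exists>y\<in>f. (x, y) \<in> (adj G (verts G))\<^sup>*")
    case True
    then obtain x y where "x \<in> e" "y \<in> f" "(x, y) \<in> (adj G (verts G))\<^sup>*" by blast
    then obtain a b c d xs where q: "is_path G (a # b # xs @ [c, d])" "e = {a, b}" "f = {c, d}"
      using connecting_path_with_end_edges[OF sg e] by metis
    show ?thesis
      using P5_constrained_extend_along_path[OF fin fo ni P5 q(1)] q(2,3) ef(1) by simp
  next
    case False
    have edge: "g \<subseteq> verts G \<and> (\<forall>x\<in>g. \<forall>y\<in>g. (x, y) \<in> (adj G (e \<union> f))\<^sup>*)"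
      if g: "g \<in> edges G" "g \<subseteq> e \<union> f" for g
    proof -
      obtain u v where uv: "g = {u, v}" "u \<noteq> v" "u \<in> verts G" "v \<in> verts G"
        using edge_cases[OF sg g(1)] by blast
      then have "is_path G [u, v]" using g by (auto simp: is_path_def)
      then show ?thesis using path_connected_set[of G "[u, v]" _ _ "e \<union> f"] uv g by auto
    qed
    have "relatively_connected G (e \<union> f)"
      unfolding relatively_connected_def
      using False edge[OF e(1)] edge[OF e(2)] rtrancl_adj_sym[of _ _ G "verts G"] by blast
    then show ?thesis
      using M ef by (intro matching_extends_greedily[OF fin fo ni, where R = "e \<union> f"]) auto
  qed
qed

section \<open>Maximal stars\<close>

lemma edges_at_two_edges:
  assumes "{v, a} \<in> edges_at G u" "{v, b} \<in> edges_at G u" "a \<noteq> b"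
  shows "u = v"
  using assms by (auto simp: edges_at_def)

text \<open>Two distinct edges at \<open>v\<close> have only \<open>v\<close> in common, so the star
  at no other vertex contains both.\<close>

lemma maximal_star_two_edges:
  assumes "simple_graph G" "{v, a} \<in> edges G" "{v, b} \<in> edges G" "a \<noteq> b"
  shows "edges_at G v \<in> maximal_stars G"
proof -
  have "v \<in> verts G" using edge_verts(1)[OF assms(1,2)] .
  moreover have "\<not> edges_at G v \<subset> edges_at G u" for u
  proof
    assume s: "edges_at G v \<subset> edges_at G u"
    have "{v, a} \<in> edges_at G v" "{v, b} \<in> edges_at G v" using assms by (auto simp: edges_at_def)
    with s have "u = v" using edges_at_two_edges[OF _ _ assms(4)] by blast
    with s show False by blast
  qed
  ultimately show ?thesis unfolding maximal_stars_def by blast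
qed

section \<open>Necessity of the P5 condition\<close>

lemma P5_obstruction:
  assumes fin: "finite (verts G)" and sg: "simple_graph G" and "\<not> P5_constrained G"
  obtains a' a v b b' where "is_path G [a', a, v, b, b']" "nbrs G v = {a, b}"
proof -
  obtain p where p: "is_path G p" "length p = 5" "graph_degree G (p ! 2) < 3"
    using assms(3) unfolding P5_constrained_def by fastforce
  then obtain a' a v b b' where pe: "p = [a', a, v, b, b']"
    by (auto simp: numeral_eq_Suc length_Suc_conv)
  have ab: "a \<noteq> b" "{a, b} \<subseteq> nbrs G v"
    using p(1) by (auto simp: pe is_path_def nbrs_def insert_commute)
  have "card (nbrs G v) < 3" using p(3) by (simp add: pe graph_degree_eq_card_nbrs[OF sg])
  with ab have "card (nbrs G v) \<le> card {a, b}" by simp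
  then have "nbrs G v = {a, b}" using card_seteq[OF finite_nbrs[OF fin sg] ab(2)] by simp
  with p(1) pe show ?thesis using that by blast
qed

lemma extends_imp_P5_constrained:
  assumes fin: "finite (verts G)" and sg: "simple_graph G"
    and b: "every_k_matching_extends G 2"
  shows "P5_constrained G"
proof (rule ccontr)
  assume "\<not> P5_constrained G"
  then obtain a' a v b b' where p: "is_path G [a', a, v, b, b']" and nb: "nbrs G v = {a, b}"
    using P5_obstruction[OF fin sg] by blast
  let ?M = "{{a', a}, {b, b'}}"
  have "k_matching G 2 ?M"
    using p by (auto simp: k_matching_def matching_def is_path_def pairwise_insert disjnt_def
        doubleton_eq_iff card_2_iff)
  then obtain M' where M': "perfect_internal_matching G M'" "?M \<subseteq> M'"
    using b by (auto simp: every_k_matching_extends_def)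
  have "graph_degree G v \<noteq> 1"
    using p nb by (simp add: graph_degree_eq_card_nbrs[OF sg] is_path_def)
  then obtain e where e: "e \<in> M'" "v \<in> e"
    using M' p by (auto simp: perfect_internal_matching_def is_path_def)
  then have "e \<in> edges G" using M' by (auto simp: perfect_internal_matching_def matching_def)
  then obtain w where w: "e = {v, w}" using edge_cases_at[OF sg _ e(2)] by blast
  have "w = a \<or> w = b" using nb w \<open>e \<in> edges G\<close> by (auto simp: nbrs_def)
  moreover have "e \<noteq> {a', a}" "e \<noteq> {b, b'}" using e(2) p by (auto simp: is_path_def)
  moreover have "pairwise disjnt M'" using M' by (simp add: perfect_internal_matching_def matching_def)
  \<comment> \<open>The edge covering \<open>v\<close> ends in \<open>a\<close> or \<open>b\<close>,
    where it meets a different edge of the matching.\<close>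
  ultimately show False using M'(2) e(1) w
    by (metis disjnt_insert1 insertCI insert_subset pairwiseD disjnt_sym)
qed

lemma not_P5_constrained_heavy_set:
  assumes fin: "finite (verts G)" and fo: "forest G" and n: "\<not> P5_constrained G"
  obtains T where "T \<in> nonmaximal_sets G"
    "\<And>\<phi> :: 'a set \<Rightarrow> real. (\<And>S. S \<in> maximal_stars G \<Longrightarrow> sum \<phi> S = 1) \<Longrightarrow> sum \<phi> T = 1"
proof -
  have sg: "simple_graph G" using fo by (simp add: forest_def)
  obtain a' a v b b' where p: "is_path G [a', a, v, b, b']" and nb: "nbrs G v = {a, b}"
    using P5_obstruction[OF fin sg n] by blast
  have Ev: "edges_at G v = {{a, v}, {v, b}}"
    by (simp add: edges_at_eq_image[OF sg] nb insert_commute)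
  let ?A = "edges_at G a - {{a, v}}" and ?B = "edges_at G b - {{v, b}}"
  have e: "{a', a} \<in> edges G" "{a, v} \<in> edges G" "{v, b} \<in> edges G" "{b, b'} \<in> edges G"
    and d: "distinct [a', a, v, b, b']"
    using p by (auto simp: is_path_def)
  have max: "edges_at G a \<in> maximal_stars G" "edges_at G v \<in> maximal_stars G"
    "edges_at G b \<in> maximal_stars G"
    using e d maximal_star_two_edges[OF sg, of a a' v] maximal_star_two_edges[OF sg, of v a b]
      maximal_star_two_edges[OF sg, of b v b'] by (auto simp: insert_commute)
  have AB: "{a', a} \<in> ?A" "{b, b'} \<in> ?B"
    using e d by (auto simp: edges_at_def doubleton_eq_iff)
  \<comment> \<open>The union contains the disjoint edges \<open>{a', a}\<close> and
    \<open>{b, b'}\<close>, so it is contained in no star.\<close>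
  have "?A \<union> ?B \<notin> maximal_stars G"
  proof
    assume "?A \<union> ?B \<in> maximal_stars G"
    then obtain u where u: "?A \<union> ?B = edges_at G u" unfolding maximal_stars_def by blast
    have "{a', a} \<in> edges_at G u" "{b, b'} \<in> edges_at G u" unfolding u[symmetric] using AB by blast+
    then have "u \<in> {a', a}" "u \<in> {b, b'}" by (simp_all add: edges_at_def)
    with d show False by auto
  qed
  then have T: "?A \<union> ?B \<in> nonmaximal_sets G" using AB by (auto simp: nonmaximal_sets_def edges_at_def)
  \<comment> \<open>A common edge would be \<open>{a, b}\<close>, which forms a triangle with
    \<open>v\<close>. Disjointness is what makes the weights of the two parts add up.\<close>
  have disj: "?A \<inter> ?B = {}"
  proof (rule ccontr)
    assume "?A \<inter> ?B \<noteq> {}"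
    then obtain g where g: "g \<in> edges G" "a \<in> g" "b \<in> g"
      by (auto simp: edges_at_def)
    then have "g = {a, b}" using edge_cases_at[OF sg g(1,2)] d by force
    then show False
      using no_triangle[OF fo e(2,3)] g(1) by (simp add: insert_commute)
  qed
  have "sum \<phi> (?A \<union> ?B) = 1" if s: "\<And>S. S \<in> maximal_stars G \<Longrightarrow> sum \<phi> S = 1"
    for \<phi> :: "'a set \<Rightarrow> real"
  proof -
    note fs = finite_edges_at[OF fin sg]
    have "sum \<phi> (?A \<union> ?B) = sum \<phi> ?A + sum \<phi> ?B" using fs disj by (intro sum.union_disjoint) auto
    also have "sum \<phi> ?A = 1 - \<phi> {a, v}"
      using s[OF max(1)] e fs by (simp add: sum_diff1 edges_at_def)
    also have "sum \<phi> ?B = 1 - \<phi> {v, b}"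
      using s[OF max(3)] e fs by (simp add: sum_diff1 edges_at_def)
    finally have "sum \<phi> (?A \<union> ?B) = 2 - (\<phi> {a, v} + \<phi> {v, b})" by simp
    moreover have "\<phi> {a, v} + \<phi> {v, b} = 1"
      using s[OF max(2)] d by (simp add: Ev doubleton_eq_iff)
    ultimately show ?thesis by simp
  qed
  with T show ?thesis using that by blast
qed

lemma strongly_equistarable_imp_P5_constrained:
  assumes fin: "finite (verts G)" and fo: "forest G" and c: "strongly_equistarable G"
  shows "P5_constrained G"
proof (rule ccontr)
  assume "\<not> P5_constrained G"
  then obtain T where T: "T \<in> nonmaximal_sets G"
    "\<And>\<phi> :: 'a set \<Rightarrow> real. (\<And>S. S \<in> maximal_stars G \<Longrightarrow> sum \<phi> S = 1) \<Longrightarrow> sum \<phi> T = 1"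
    using not_P5_constrained_heavy_set[OF fin fo] by blast
  \<comment> \<open>The contradiction comes from strong equistarability at \<gamma> = 1.\<close>
  from c T(1) obtain \<phi> :: "'a set \<Rightarrow> real" where
    "\<forall>S\<in>maximal_stars G. sum \<phi> S = 1" "sum \<phi> T \<noteq> 1"
    unfolding strongly_equistarable_def by (meson order_refl)
  with T(2) show False by blast
qed

lemma equistarable_imp_P5_constrained:
  assumes fin: "finite (verts G)" and fo: "forest G" and d: "equistarable G"
  shows "P5_constrained G"
proof (rule ccontr)
  assume "\<not> P5_constrained G"
  then obtain T where T: "T \<in> nonmaximal_sets G"
    "\<And>\<phi> :: 'a set \<Rightarrow> real. (\<And>S. S \<in> maximal_stars G \<Longrightarrow> sum \<phi> S = 1) \<Longrightarrow> sum \<phi> T = 1"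
    using not_P5_constrained_heavy_set[OF fin fo] by blast
  from d obtain \<phi> :: "'a set \<Rightarrow> real" where
    \<phi>: "\<And>F. F \<subseteq> edges G \<Longrightarrow> F \<in> maximal_stars G \<longleftrightarrow> sum \<phi> F = 1"
    unfolding equistarable_def by blast
  have "S \<subseteq> edges G" if "S \<in> maximal_stars G" for S
    using that by (auto simp: maximal_stars_def edges_at_def)
  then have "sum \<phi> T = 1" using \<phi> by (intro T(2)) blast
  then show False using \<phi>[of T] T(1) by (simp add: nonmaximal_sets_def)
qed

section \<open>Weights from perfect internal matchings\<close>

text \<open>If some edge is disjoint from \<open>e\<close>, the two form a 2-matching. Otherwise
  every edge meets \<open>e\<close>, and a vertex off \<open>e\<close> adjacent to both ends of
  \<open>e\<close> would give a triangle, so all these vertices are leaves and \<open>{e}\<close>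
  suffices.\<close>

lemma edge_extends_to_perfect_internal_matching:
  assumes fo: "forest G" and ni: "no_isolated_vertices G"
    and b: "every_k_matching_extends G 2" and e: "e \<in> edges G"
  obtains M where "perfect_internal_matching G M" "e \<in> M"
proof (cases "\<exists>f\<in>edges G. disjnt e f")
  case True
  then obtain f where f: "f \<in> edges G" "disjnt e f" by blast
  have sg: "simple_graph G" using fo by (simp add: forest_def)
  have "e \<noteq> {}" using edge_cases[OF sg e] by blast
  with f have "e \<noteq> f" by (auto simp: disjnt_def)
  then have "k_matching G 2 {e, f}"
    using e f by (auto simp: k_matching_def matching_def pairwise_insert disjnt_sym)
  then show ?thesis using b that unfolding every_k_matching_extends_def by blast
next
  case False
  have sg: "simple_graph G" using fo by (simp add: forest_def)
  obtain x y where xy: "e = {x, y}" "x \<noteq> y" using edge_cases[OF sg e] by blast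
  have "graph_degree G v = 1" if v: "v \<in> verts G" "v \<notin> e" for v
  proof -
    have "nbrs G v \<subseteq> e"
    proof
      fix w assume "w \<in> nbrs G v"
      then have "{v, w} \<in> edges G" by (simp add: nbrs_def)
      with False have "\<not> disjnt e {v, w}" by blast
      with v show "w \<in> e" by (auto simp: disjnt_def)
    qed
    moreover have "\<not> (x \<in> nbrs G v \<and> y \<in> nbrs G v)"
      using no_triangle[OF fo, of x y v] e xy by (auto simp: nbrs_def insert_commute)
    moreover have "nbrs G v \<noteq> {}"
      using ni v by (auto simp: no_isolated_vertices_def edges_at_eq_image[OF sg])
    ultimately have "nbrs G v = {x} \<or> nbrs G v = {y}" using xy by blast
    then show ?thesis by (auto simp: graph_degree_eq_card_nbrs[OF sg])
  qed
  then have "perfect_internal_matching G {e}"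
    using e by (auto simp: perfect_internal_matching_def matching_def)
  then show ?thesis using that by blast
qed

text \<open>Both ends of an isolated edge are leaves, so a perfect internal matching may leave it
  out. Yet it is a maximal star and must receive weight 1, so all isolated edges are put in.\<close>

lemma perfect_internal_matching_add_isolated_edges:
  assumes M: "perfect_internal_matching G M"
  shows "perfect_internal_matching G
    (M \<union> {e \<in> edges G. \<forall>f\<in>edges G. f \<noteq> e \<longrightarrow> disjnt e f})"
proof -
  have "M \<subseteq> edges G" "pairwise disjnt M"
    using M by (auto simp: perfect_internal_matching_def matching_def)
  then have "matching G (M \<union> {e \<in> edges G. \<forall>f\<in>edges G. f \<noteq> e \<longrightarrow> disjnt e f})"
    unfolding matching_def pairwise_def by (blast intro: disjnt_sym)
  then show ?thesis using M by (auto simp: perfect_internal_matching_def)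
qed

text \<open>The maximal stars are the stars at the inner vertices and the isolated edges.\<close>

lemma maximal_star_weight_1:
  assumes fin: "finite (verts G)" and sg: "simple_graph G" and ni: "no_isolated_vertices G"
    and M: "perfect_internal_matching G M"
    and iso: "\<And>e. e \<in> edges G \<Longrightarrow> (\<And>f. f \<in> edges G \<Longrightarrow> f \<noteq> e \<Longrightarrow> disjnt e f) \<Longrightarrow> e \<in> M"
    and S: "S \<in> maximal_stars G"
  shows "card (S \<inter> M) = 1"
proof -
  obtain v where v: "v \<in> verts G" "S = edges_at G v"
    and max: "\<And>u. u \<in> verts G \<Longrightarrow> \<not> edges_at G v \<subset> edges_at G u"
    using S unfolding maximal_stars_def by blast
  have M': "M \<subseteq> edges G" "pairwise disjnt M"
    using M by (auto simp: perfect_internal_matching_def matching_def)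
  \<comment> \<open>If \<open>v\<close> is uncovered, it is a leaf with a single edge
    \<open>e\<close>. Maximality of its star forces the other end of \<open>e\<close> to be a leaf
    too, so \<open>e\<close> is isolated and lies in \<open>M\<close> after all.\<close>
  have "\<exists>e\<in>M. v \<in> e"
  proof (rule ccontr)
    assume n: "\<not> ?thesis"
    with M v have "graph_degree G v = 1" by (auto simp: perfect_internal_matching_def)
    then obtain e where e: "edges_at G v = {e}"
      unfolding graph_degree_def by (auto simp: card_1_singleton_iff)
    then have "e \<in> edges G" "v \<in> e" by (auto simp: edges_at_def)
    then obtain w where w: "e = {v, w}" "w \<in> verts G" using edge_cases_at[OF sg] by metis
    have "e \<in> edges_at G w" using w \<open>e \<in> edges G\<close> by (auto simp: edges_at_def)
    then have ew: "edges_at G w = {e}" using max[OF w(2)] unfolding e by blast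
    have "disjnt e f" if f: "f \<in> edges G" "f \<noteq> e" for f
    proof -
      have "f \<notin> edges_at G v" "f \<notin> edges_at G w" using f e ew by simp_all
      then show ?thesis using f(1) w(1) by (simp add: edges_at_def)
    qed
    with iso \<open>e \<in> edges G\<close> have "e \<in> M" by blast
    with n \<open>v \<in> e\<close> show False by blast
  qed
  then obtain e where e: "e \<in> M" "v \<in> e" by blast
  have "f = e" if "f \<in> M" "v \<in> f" for f
    using that e M'(2) by (auto simp: pairwise_def disjnt_def)
  then have "S \<inter> M = {e}" using e M'(1) unfolding v(2) edges_at_def by blast
  then show ?thesis by simp
qed

lemma star_in_maximal_star:
  assumes "finite (verts G)" "simple_graph G" "v \<in> verts G"
  obtains u where "u \<in> verts G" "edges_at G v \<subseteq> edges_at G u" "edges_at G u \<in> maximal_stars G"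
proof -
  define A where "A = {S \<in> edges_at G ` verts G. edges_at G v \<subseteq> S}"
  have "finite A" "A \<noteq> {}" using assms by (auto simp: A_def)
  from finite_has_maximal[OF this] obtain S
    where S: "S \<in> A" "\<And>S'. S' \<in> A \<Longrightarrow> S \<subseteq> S' \<Longrightarrow> S' = S" by blast
  then obtain u where u: "u \<in> verts G" "S = edges_at G u" by (auto simp: A_def)
  have "\<not> edges_at G u \<subset> edges_at G w" if w: "w \<in> verts G" for w
  proof
    assume less: "edges_at G u \<subset> edges_at G w"
    then have "edges_at G w \<in> A" using S(1) u(2) w by (auto simp: A_def)
    then have "edges_at G w = S" using S(2) less u(2) by simp
    with less u(2) show False by simp
  qed
  then have "edges_at G u \<in> maximal_stars G" using u(1) unfolding maximal_stars_def by blast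
  moreover have "edges_at G v \<subseteq> edges_at G u" using S(1) u(2) by (simp add: A_def)
  ultimately show ?thesis using that u(1) by simp
qed

text \<open>The weight is the indicator function of a perfect internal matching, so the weight of
  \<open>T\<close> counts its matching edges. Two disjoint edges of \<open>T\<close> in the matching
  push the count above \<gamma>. If \<open>T\<close> lies in a star, one prescribed edge of the
  matching makes the count 0 in the case \<gamma> = 1, and at least 1 in the case \<gamma> <
  1.\<close>

lemma extends_imp_strongly_equistarable:
  assumes fin: "finite (verts G)" and fo: "forest G" and ni: "no_isolated_vertices G"
    and b: "every_k_matching_extends G 2"
  shows "strongly_equistarable G"
  unfolding strongly_equistarable_def
proof (intro conjI ni ballI allI impI)
  fix T and \<gamma> :: real assume T: "T \<in> nonmaximal_sets G" and \<gamma>: "\<gamma> \<le> 1"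
  have sg: "simple_graph G" using fo by (simp add: forest_def)
  have TE: "T \<subseteq> edges G" "T \<noteq> {}" "T \<notin> maximal_stars G" using T by (auto simp: nonmaximal_sets_def)
  have finT: "finite T" using TE finite_edges[OF fin sg] finite_subset by blast
  let ?weight = "\<exists>\<phi> :: 'a set \<Rightarrow> real. (\<forall>e\<in>edges G. \<phi> e \<ge> 0) \<and>
           (\<forall>S\<in>maximal_stars G. (\<Sum>e\<in>S. \<phi> e) = 1) \<and> (\<Sum>e\<in>T. \<phi> e) \<noteq> \<gamma>"
  \<comment> \<open>The condition ranges over all larger matchings because the weight uses
    \<open>M\<close> with the isolated edges added.\<close>
  have *: ?weight if M: "perfect_internal_matching G M" and
    ne: "\<And>M'. perfect_internal_matching G M' \<Longrightarrow> M \<subseteq> M' \<Longrightarrow> real (card (T \<inter> M')) \<noteq> \<gamma>" for M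
  proof -
    define M' where "M' = M \<union> {e \<in> edges G. \<forall>f\<in>edges G. f \<noteq> e \<longrightarrow> disjnt e f}"
    have M': "perfect_internal_matching G M'" "M \<subseteq> M'"
      using perfect_internal_matching_add_isolated_edges[OF M] by (auto simp: M'_def)
    let ?\<phi> = "\<lambda>e. if e \<in> M' then 1 else 0 :: real"
    have "sum ?\<phi> S = 1" if S: "S \<in> maximal_stars G" for S
    proof -
      have "finite S" using S finite_edges_at[OF fin sg] by (auto simp: maximal_stars_def)
      moreover have "card (S \<inter> M') = 1"
        by (rule maximal_star_weight_1[OF fin sg ni M'(1) _ S]) (auto simp: M'_def)
      ultimately show ?thesis by (simp add: sum.If_cases)
    qed
    moreover have "sum ?\<phi> T \<noteq> \<gamma>" using ne[OF M'] finT by (simp add: sum.If_cases)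
    ultimately show ?weight by (intro exI[of _ ?\<phi>]) auto
  qed
  show ?weight
  proof (cases "\<exists>e\<in>T. \<exists>f\<in>T. disjnt e f")
    case True
    then obtain e f where ef: "e \<in> T" "f \<in> T" "disjnt e f" by blast
    have "e \<noteq> {}" using edge_cases[OF sg, of e] ef TE by blast
    with ef have "e \<noteq> f" by (auto simp: disjnt_def)
    then have "k_matching G 2 {e, f}"
      using ef TE by (auto simp: k_matching_def matching_def pairwise_insert disjnt_sym)
    then obtain M where M: "perfect_internal_matching G M" "{e, f} \<subseteq> M"
      using b unfolding every_k_matching_extends_def by blast
    show ?thesis
    proof (rule *[OF M(1)])
      fix M' assume "M \<subseteq> M'"
      then have "{e, f} \<subseteq> T \<inter> M'" using M ef by blast
      then have "card {e, f} \<le> card (T \<inter> M')" using finT by (intro card_mono) auto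
      then show "real (card (T \<inter> M')) \<noteq> \<gamma>" using \<open>e \<noteq> f\<close> \<gamma> by simp
    qed
  next
    case False
    then obtain v where v: "v \<in> verts G" "T \<subseteq> edges_at G v"
      using intersecting_edges_in_star[OF fo TE(1,2)] by blast
    obtain u where u: "edges_at G v \<subseteq> edges_at G u" "edges_at G u \<in> maximal_stars G"
      using star_in_maximal_star[OF fin sg v(1)] by blast
    have "\<exists>e\<in>edges G. \<forall>M. perfect_internal_matching G M \<longrightarrow> e \<in> M \<longrightarrow> real (card (T \<inter> M)) \<noteq> \<gamma>"
    proof (cases "\<gamma> = 1")
      case True
      have "T \<noteq> edges_at G u" using u TE by auto
      then obtain e where e: "e \<in> edges_at G u" "e \<notin> T" using u v by blast
      \<comment> \<open>\<open>T\<close> is a proper subset of the maximal star at \<open>u\<close>.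
        A star edge \<open>e\<close> outside \<open>T\<close> meets every edge of \<open>T\<close>,
        so a matching through \<open>e\<close> avoids \<open>T\<close>.\<close>
      have "T \<inter> M = {}" if M: "perfect_internal_matching G M" "e \<in> M" for M
      proof -
        have "\<not> disjnt e f" if "f \<in> T" for f using that e u v by (auto simp: edges_at_def disjnt_def)
        moreover have "disjnt e f" if "f \<in> M" "f \<noteq> e" for f
          using M that by (auto simp: perfect_internal_matching_def matching_def pairwise_def)
        ultimately show ?thesis using e by blast
      qed
      then show ?thesis using e True by (intro bexI[of _ e]) (auto simp: edges_at_def)
    next
      case ne: False
      obtain e where e: "e \<in> T" using TE by blast
      have "card (T \<inter> M) \<ge> 1" if "e \<in> M" for M
      proof -
        have "T \<inter> M \<noteq> {}" using e that by blast
        then show ?thesis using finT by (simp add: Suc_le_eq card_gt_0_iff)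
      qed
      then show ?thesis using e TE ne \<gamma> by (intro bexI[of _ e]) fastforce+
    qed
    then obtain e where e: "e \<in> edges G"
      "\<And>M. perfect_internal_matching G M \<Longrightarrow> e \<in> M \<Longrightarrow> real (card (T \<inter> M)) \<noteq> \<gamma>" by blast
    obtain M where "perfect_internal_matching G M" "e \<in> M"
      using edge_extends_to_perfect_internal_matching[OF fo ni b e(1)] .
    then show ?thesis using e(2) by (intro *[of M]) auto
  qed
qed

text \<open>On a segment between two weights, a set of weight other than 1 at one of the two ends has
  weight 1 at no more than one point, so a point avoiding finitely many such sets exists.\<close>

lemma weight_avoiding_sets:
  assumes "finite \<T>"
    and "\<And>T. T \<in> \<T> \<Longrightarrow> \<exists>\<phi> :: 'a \<Rightarrow> real. (\<forall>e\<in>E. \<phi> e \<ge> 0) \<and> (\<forall>S\<in>\<S>. sum \<phi> S = 1) \<and> sum \<phi> T \<noteq> 1"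
    and "\<exists>\<phi> :: 'a \<Rightarrow> real. (\<forall>e\<in>E. \<phi> e \<ge> 0) \<and> (\<forall>S\<in>\<S>. sum \<phi> S = 1)"
  shows "\<exists>\<phi> :: 'a \<Rightarrow> real. (\<forall>e\<in>E. \<phi> e \<ge> 0) \<and> (\<forall>S\<in>\<S>. sum \<phi> S = 1) \<and> (\<forall>T\<in>\<T>. sum \<phi> T \<noteq> 1)"
  using assms(1,2)
proof (induction \<T> rule: finite_induct)
  case empty
  then show ?case using assms(3) by simp
next
  case (insert T \<T>)
  have "\<exists>\<phi> :: 'a \<Rightarrow> real. (\<forall>e\<in>E. \<phi> e \<ge> 0) \<and> (\<forall>S\<in>\<S>. sum \<phi> S = 1) \<and> (\<forall>T\<in>\<T>. sum \<phi> T \<noteq> 1)"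
    by (rule insert.IH) (rule insert.prems, simp)
  then obtain \<phi> :: "'a \<Rightarrow> real" where
    \<phi>: "\<And>e. e \<in> E \<Longrightarrow> \<phi> e \<ge> 0" "\<And>S. S \<in> \<S> \<Longrightarrow> sum \<phi> S = 1"
      "\<And>T'. T' \<in> \<T> \<Longrightarrow> sum \<phi> T' \<noteq> 1" by auto
  obtain \<psi> :: "'a \<Rightarrow> real" where
    \<psi>: "\<And>e. e \<in> E \<Longrightarrow> \<psi> e \<ge> 0" "\<And>S. S \<in> \<S> \<Longrightarrow> sum \<psi> S = 1" "sum \<psi> T \<noteq> 1"
    using insert.prems[of T] by auto
  \<comment> \<open>\<phi> is good for the sets treated so far and \<psi> for the new set
    \<open>T\<close>; each set thus has a weight other than 1 at one of the two ends.\<close>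
  define \<chi> where "\<chi> t e = (1 - t) * \<phi> e + t * \<psi> e" for t :: real and e
  have \<chi>: "sum (\<chi> t) A = (1 - t) * sum \<phi> A + t * sum \<psi> A" for t A
    by (simp add: \<chi>_def sum.distrib sum_distrib_left)
  let ?bad = "\<lambda>A. {t. sum (\<chi> t) A = 1}"
  \<comment> \<open>The weight of \<open>A\<close> is affine in \<open>t\<close>. Taking the value 1
    twice would make it constantly 1, also at both ends.\<close>
  have fb: "finite (?bad A)" if "sum \<phi> A \<noteq> 1 \<or> sum \<psi> A \<noteq> 1" for A
  proof -
    have "s = t" if "s \<in> ?bad A" "t \<in> ?bad A" for s t
    proof (rule ccontr)
      assume "s \<noteq> t"
      have eq: "sum \<phi> A + s * (sum \<psi> A - sum \<phi> A) = 1" "sum \<phi> A + t * (sum \<psi> A - sum \<phi> A) = 1"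
        using that by (auto simp: \<chi> algebra_simps)
      then have "s * (sum \<psi> A - sum \<phi> A) = t * (sum \<psi> A - sum \<phi> A)" by linarith
      with \<open>s \<noteq> t\<close> have "sum \<psi> A = sum \<phi> A" by simp
      with eq show False using \<open>sum \<phi> A \<noteq> 1 \<or> sum \<psi> A \<noteq> 1\<close> by simp
    qed
    then have "?bad A = {} \<or> (\<exists>t. ?bad A = {t})" by blast
    then show ?thesis by (metis finite.emptyI finite_insert)
  qed
  have "finite (\<Union>A\<in>insert T \<T>. ?bad A)"
    using insert.hyps(1) fb \<phi>(3) \<psi>(3) by blast
  \<comment> \<open>Restricting \<open>t\<close> to the unit interval keeps \<chi> a convex
    combination and hence nonnegative.\<close>
  moreover have "infinite {0<..<1::real}" by (simp add: infinite_Ioo)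
  ultimately obtain t where t: "t \<in> {0<..<1}" "t \<notin> (\<Union>A\<in>insert T \<T>. ?bad A)"
    by (meson finite_subset subsetI)
  have "\<chi> t e \<ge> 0" if "e \<in> E" for e using \<phi>(1) \<psi>(1) that t by (simp add: \<chi>_def)
  moreover have "sum (\<chi> t) S = 1" if "S \<in> \<S>" for S using \<phi>(2) \<psi>(2) that by (simp add: \<chi>)
  ultimately show ?case using t(2) by (intro exI[of _ "\<chi> t"]) blast
qed

lemma maximal_stars_antichain:
  assumes "S \<in> maximal_stars G" "S' \<in> maximal_stars G" "S \<subseteq> S'"
  shows "S = S'"
proof -
  obtain v where v: "S = edges_at G v" "\<not> (\<exists>u\<in>verts G. edges_at G v \<subset> edges_at G u)"
    using assms(1) unfolding maximal_stars_def by blast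
  obtain u where u: "S' = edges_at G u" "u \<in> verts G"
    using assms(2) unfolding maximal_stars_def by blast
  have "\<not> S \<subset> S'" unfolding u(1) v(1) using v(2) u(2) by blast
  with assms(3) show ?thesis by simp
qed

text \<open>There are only finitely many nonmaximal sets, so the separate weights for \<gamma> = 1
  merge into one weight that differs from 1 on all of them.\<close>

lemma strongly_equistarable_imp_equistarable:
  assumes fin: "finite (verts G)" and sg: "simple_graph G" and c: "strongly_equistarable G"
  shows "equistarable G"
proof -
  let ?E = "edges G"
  have ni: "no_isolated_vertices G" using c by (simp add: strongly_equistarable_def)
  have finE: "finite ?E" using finite_edges[OF fin sg] .
  have sub: "S \<subseteq> ?E" "S \<noteq> {}" if "S \<in> maximal_stars G" for S
    using that ni by (auto simp: maximal_stars_def edges_at_def no_isolated_vertices_def)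
  have "finite (nonmaximal_sets G)"
    by (rule finite_subset[of _ "Pow ?E"]) (use finE in \<open>auto simp: nonmaximal_sets_def\<close>)
  moreover have ex: "\<exists>\<phi> :: 'a set \<Rightarrow> real. (\<forall>e\<in>?E. \<phi> e \<ge> 0) \<and>
      (\<forall>S\<in>maximal_stars G. sum \<phi> S = 1) \<and> sum \<phi> T \<noteq> 1" if "T \<in> nonmaximal_sets G" for T
    using c[unfolded strongly_equistarable_def, THEN conjunct2, rule_format, OF that, of 1] by simp
  moreover have "\<exists>\<phi> :: 'a set \<Rightarrow> real. (\<forall>e\<in>?E. \<phi> e \<ge> 0) \<and> (\<forall>S\<in>maximal_stars G. sum \<phi> S = 1)"
  proof (cases "nonmaximal_sets G = {}")
    case False
    then show ?thesis using ex by blast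
  next
    case True
    \<comment> \<open>Here no set \<open>T\<close> supplies a weight. Every single edge is then a
      maximal star, and by the antichain property there are no others, so the constant 1
      works.\<close>
    have "sum (\<lambda>_. 1 :: real) S = 1" if S: "S \<in> maximal_stars G" for S
    proof -
      obtain e where e: "e \<in> S" using sub[OF S] by blast
      then have "{e} \<subseteq> ?E" using sub[OF S] by blast
      with True have "{e} \<in> maximal_stars G" unfolding nonmaximal_sets_def by blast
      then have "{e} = S" using S e by (intro maximal_stars_antichain) simp_all
      then show ?thesis by auto
    qed
    then show ?thesis by (intro exI[of _ "\<lambda>_. 1"]) simp
  qed
  ultimately obtain \<phi> :: "'a set \<Rightarrow> real" where
    \<phi>: "\<forall>e\<in>?E. \<phi> e \<ge> 0" "\<forall>S\<in>maximal_stars G. sum \<phi> S = 1" "\<forall>T\<in>nonmaximal_sets G. sum \<phi> T \<noteq> 1"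
    using weight_avoiding_sets[of "nonmaximal_sets G" ?E "maximal_stars G"] by blast
  have "F \<in> maximal_stars G \<longleftrightarrow> sum \<phi> F = 1" if "F \<subseteq> ?E" for F
  proof (cases "F = {}")
    case True
    \<comment> \<open>The empty set has weight 0, and no maximal star is empty because there are no
      isolated vertices.\<close>
    then show ?thesis using sub(2) by auto
  next
    case False
    with that have "F \<notin> maximal_stars G \<Longrightarrow> F \<in> nonmaximal_sets G" by (simp add: nonmaximal_sets_def)
    then show ?thesis using \<phi> by blast
  qed
  with \<phi>(1) ni show ?thesis unfolding equistarable_def by blast
qed

section \<open>Connected components\<close>

text \<open>Replaces the quotient construction by the facts about a component used later: its vertex
  set is closed under adjacency and connected within itself. A walk starting at the representative
  \<open>x\<close> never leaves the class of \<open>x\<close>.\<close>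

lemma graph_component_cases:
  assumes sg: "simple_graph G" and C: "C \<in> graph_components G"
  obtains V where "C = induced_subgraph G V" "V \<subseteq> verts G" "V \<noteq> {}"
    "\<And>u w. u \<in> V \<Longrightarrow> {u, w} \<in> edges G \<Longrightarrow> w \<in> V"
    "\<And>u w. u \<in> V \<Longrightarrow> w \<in> V \<Longrightarrow> (u, w) \<in> (adj G V)\<^sup>*"
proof -
  obtain x where x: "x \<in> verts G" "C = induced_subgraph G (connected_rel G `` {x})"
    using C unfolding graph_components_def quotient_def by blast
  define V where "V = connected_rel G `` {x}"
  have V: "y \<in> V \<longleftrightarrow> y \<in> verts G \<and> (x, y) \<in> (adj G (verts G))\<^sup>*" for y
    using x(1) by (auto simp: V_def connected_rel_eq)
  have sub: "V \<subseteq> verts G" and ne: "V \<noteq> {}" using V x(1) by blast+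
  have closed: "w \<in> V" if "u \<in> V" "{u, w} \<in> edges G" for u w
  proof -
    have "w \<in> verts G" using edge_verts(2)[OF sg that(2)] .
    moreover from this have "(u, w) \<in> adj G (verts G)" using that V by (auto simp: adj_def)
    ultimately show ?thesis using that V by (meson rtrancl_into_rtrancl)
  qed
  have x_reach: "(x, y) \<in> (adj G V)\<^sup>*" if "(x, y) \<in> (adj G (verts G))\<^sup>*" for y
    using that
  proof (induction rule: rtrancl_induct)
    case (step y z)
    have "y \<in> V" "z \<in> V"
      using step.hyps V rtrancl_into_rtrancl[OF step.hyps] by (auto simp: adj_def)
    then have "(y, z) \<in> adj G V" using step.hyps by (auto simp: adj_def)
    with step.IH show ?case by (rule rtrancl_into_rtrancl)
  qed simp
  have "(u, w) \<in> (adj G V)\<^sup>*" if "u \<in> V" "w \<in> V" for u w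
    using that V x_reach by (meson rtrancl_adj_sym rtrancl_trans)
  with x(2) sub ne closed that show ?thesis unfolding V_def by blast
qed

lemma is_path_induced_subgraph:
  assumes "V \<subseteq> verts G"
  shows "is_path (induced_subgraph G V) p \<longleftrightarrow> is_path G p \<and> set p \<subseteq> V"
proof -
  have "successively (\<lambda>u v. {u, v} \<in> edges (induced_subgraph G V)) p \<longleftrightarrow>
      successively (\<lambda>u v. {u, v} \<in> edges G) p" if "set p \<subseteq> V"
    using that by (intro successively_cong) (auto simp: induced_subgraph_def)
  then show ?thesis using assms by (auto simp: is_path_def induced_subgraph_def)
qed

lemma forest_induced_subgraph:
  assumes fo: "forest G" and V: "V \<subseteq> verts G"
  shows "forest (induced_subgraph G V)"
proof -
  have "simple_graph (induced_subgraph G V)"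
    unfolding simple_graph_def
  proof
    fix e assume "e \<in> edges (induced_subgraph G V)"
    then have e: "e \<in> edges G" "e \<subseteq> V" by (auto simp: induced_subgraph_def)
    obtain u v where "e = {u, v}" "u \<noteq> v"
      using edge_cases[OF _ e(1)] fo unfolding forest_def by blast
    with e(2) show "\<exists>u\<in>verts (induced_subgraph G V). \<exists>v\<in>verts (induced_subgraph G V).
        u \<noteq> v \<and> e = {u, v}" by (auto simp: induced_subgraph_def)
  qed
  moreover have "is_cycle G p" if "is_cycle (induced_subgraph G V) p" for p
    using that is_path_induced_subgraph[OF V] by (auto simp: is_cycle_def induced_subgraph_def)
  ultimately show ?thesis using fo unfolding forest_def by blast
qed

lemma edges_at_component:
  assumes sg: "simple_graph G" and closed: "\<And>u w. u \<in> V \<Longrightarrow> {u, w} \<in> edges G \<Longrightarrow> w \<in> V"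
    and v: "v \<in> V"
  shows "edges_at (induced_subgraph G V) v = edges_at G v"
proof -
  have "e \<subseteq> V" if e: "e \<in> edges G" "v \<in> e" for e
  proof -
    obtain w where "e = {v, w}" using edge_cases_at[OF sg e] by blast
    with closed v e(1) show ?thesis by blast
  qed
  then show ?thesis by (auto simp: edges_at_def induced_subgraph_def)
qed

lemma connected_induced_subgraph:
  assumes "V \<noteq> {}" "\<And>u w. u \<in> V \<Longrightarrow> w \<in> V \<Longrightarrow> (u, w) \<in> (adj G V)\<^sup>*"
  shows "connected_graph (induced_subgraph G V)"
proof -
  have "adj (induced_subgraph G V) V = adj G V" by (auto simp: adj_def induced_subgraph_def)
  then show ?thesis
    using assms by (auto simp: connected_graph_def connected_rel_eq induced_subgraph_def)
qed

section \<open>Stars as trees without disjoint edges\<close>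

text \<open>Every edge contains the vertex that the isomorphism sends to the centre 0.\<close>

lemma star_edges_intersect:
  assumes st: "is_star G" and sg: "simple_graph G" and ef: "e \<in> edges G" "f \<in> edges G"
  shows "\<not> disjnt e f"
proof -
  obtain n h where h: "bij_betw h (verts G) (verts (K1 n))"
    "\<And>u v. u \<in> verts G \<Longrightarrow> v \<in> verts G \<Longrightarrow> {u, v} \<in> edges G \<longleftrightarrow> {h u, h v} \<in> edges (K1 n)"
    using st unfolding is_star_def graph_iso_def by blast
  have centre: "\<exists>x\<in>g. x \<in> verts G \<and> h x = 0" if g: "g \<in> edges G" for g
  proof -
    obtain u v where uv: "g = {u, v}" "u \<in> verts G" "v \<in> verts G" using edge_cases[OF sg g] by blast
    then have "{h u, h v} \<in> edges (K1 n)" using h(2) g by blast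
    then have "h u = 0 \<or> h v = 0" by (auto simp: K1_def doubleton_eq_iff)
    with uv show ?thesis by auto
  qed
  obtain x where x: "x \<in> e" "x \<in> verts G" "h x = 0" using centre[OF ef(1)] by blast
  obtain y where y: "y \<in> f" "y \<in> verts G" "h y = 0" using centre[OF ef(2)] by blast
  have "x = y" using inj_onD[OF bij_betw_imp_inj_on[OF h(1)]] x y by simp
  with x y show ?thesis by (auto simp: disjnt_def)
qed

text \<open>All edges share a vertex \<open>v\<close>. Every other vertex lies on some edge and is
  therefore adjacent to \<open>v\<close>, which serves as the centre.\<close>

lemma intersecting_edges_imp_star:
  assumes fin: "finite (verts G)" and fo: "forest G" and ni: "no_isolated_vertices G"
    and ne: "verts G \<noteq> {}"
    and int: "\<And>e f. e \<in> edges G \<Longrightarrow> f \<in> edges G \<Longrightarrow> \<not> disjnt e f"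
  shows "is_star G"
proof -
  have sg: "simple_graph G" using fo by (simp add: forest_def)
  obtain x where "x \<in> verts G" using ne by blast
  then have "edges G \<noteq> {}" using ni by (auto simp: no_isolated_vertices_def edges_at_def)
  then obtain v where v: "v \<in> verts G" "edges G \<subseteq> edges_at G v"
    using intersecting_edges_in_star[OF fo order_refl _ int] by blast
  have nb: "{v, w} \<in> edges G" if w: "w \<in> verts G" "w \<noteq> v" for w
  proof -
    obtain e where e: "e \<in> edges G" "w \<in> e" using ni w by (auto simp: no_isolated_vertices_def edges_at_def)
    then have "v \<in> e" using v by (auto simp: edges_at_def)
    then obtain y where "e = {v, y}" using edge_cases_at[OF sg e(1)] by blast
    with e w show ?thesis by auto
  qed
  let ?W = "verts G - {v}"
  have "?W \<noteq> {}"
  proof -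
    obtain e where e: "e \<in> edges G" "v \<in> e"
      using ni v(1) by (auto simp: no_isolated_vertices_def edges_at_def)
    then obtain y where "v \<noteq> y" "y \<in> verts G" using edge_cases_at[OF sg] by blast
    then show ?thesis by blast
  qed
  then have n: "card ?W \<ge> 1" using fin by (simp add: Suc_le_eq card_gt_0_iff)
  obtain h where h: "bij_betw h ?W {1..card ?W}"
    using ex_bij_betw_finite_nat[of ?W] ex_bij_betw_nat_finite_1[of ?W] fin bij_betw_inv by blast
  \<comment> \<open>\<open>h\<close> numbers the leaves from 1, which leaves 0 for the
    centre.\<close>
  define h' where "h' = h(v := 0)"
  have W: "h' w \<in> {1..card ?W}" if "w \<in> verts G" "w \<noteq> v" for w
    using bij_betwE[OF h] that by (auto simp: h'_def)
  have "bij_betw h' ?W {1..card ?W}"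
    using h bij_betw_cong[of ?W h h' "{1..card ?W}"] by (simp add: h'_def)
  moreover have "bij_betw h' {v} {0}" by (simp add: h'_def bij_betw_def)
  ultimately have "bij_betw h' (?W \<union> {v}) ({1..card ?W} \<union> {0})" by (rule bij_betw_combine) simp
  moreover have "?W \<union> {v} = verts G" using v(1) by blast
  moreover have "{1..card ?W} \<union> {0} = verts (K1 (card ?W))" by (auto simp: K1_def)
  ultimately have "bij_betw h' (verts G) (verts (K1 (card ?W)))" by simp
  moreover have "{u, w} \<in> edges G \<longleftrightarrow> {h' u, h' w} \<in> edges (K1 (card ?W))"
    if uw: "u \<in> verts G" "w \<in> verts G" for u w
  proof -
    have h0: "h' z = 0 \<longleftrightarrow> z = v" if "z \<in> verts G" for z using W[of z] that by (auto simp: h'_def)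
    have "{u, w} \<in> edges G \<longleftrightarrow> (u = v \<and> w \<noteq> v) \<or> (w = v \<and> u \<noteq> v)"
    proof
      assume e: "{u, w} \<in> edges G"
      have "u \<noteq> w" using edge_verts(3)[OF sg e] .
      moreover have "v \<in> {u, w}" using e v(2) by (auto simp: edges_at_def)
      ultimately show "(u = v \<and> w \<noteq> v) \<or> (w = v \<and> u \<noteq> v)" by blast
    next
      assume "(u = v \<and> w \<noteq> v) \<or> (w = v \<and> u \<noteq> v)"
      then show "{u, w} \<in> edges G" using nb[of u] nb[of w] uw by (metis insert_commute)
    qed
    also have "\<dots> \<longleftrightarrow> (h' u = 0 \<and> h' w \<in> {1..card ?W}) \<or> (h' w = 0 \<and> h' u \<in> {1..card ?W})"
      using h0 W uw by (metis atLeastAtMost_iff not_one_le_zero)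
    also have "\<dots> \<longleftrightarrow> {h' u, h' w} \<in> edges (K1 (card ?W))"
      by (auto simp: K1_def doubleton_eq_iff)
    finally show ?thesis .
  qed
  ultimately show ?thesis using n unfolding is_star_def graph_iso_def by blast
qed

section \<open>Condition (a) and the P5 condition\<close>

text \<open>A path on five vertices stays in one component, and its two end edges are disjoint, so
  that component is no star and its 2-matchings extend. Degrees in the component agree with those in
  \<open>G\<close>.\<close>

lemma components_imp_P5_constrained:
  assumes fin: "finite (verts G)" and fo: "forest G"
    and a: "\<forall>C\<in>graph_components G. is_star C \<or> internally_extendable 2 C"
  shows "P5_constrained G"
  unfolding P5_constrained_def
proof (intro allI impI)
  fix p assume p: "is_path G p \<and> length p = 5"
  have sg: "simple_graph G" using fo by (simp add: forest_def)
  have hd: "hd p \<in> verts G" using p by (auto simp: is_path_def)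
  define C where "C = induced_subgraph G (connected_rel G `` {hd p})"
  have "C \<in> graph_components G"
    using hd unfolding C_def graph_components_def quotient_def by blast
  with a have C: "is_star C \<or> internally_extendable 2 C"
    and "\<exists>V. C = induced_subgraph G V \<and> V \<subseteq> verts G \<and>
      (\<forall>u w. u \<in> V \<longrightarrow> {u, w} \<in> edges G \<longrightarrow> w \<in> V)"
    using graph_component_cases[OF sg, of C] by metis+
  then obtain V where V: "C = induced_subgraph G V" "V \<subseteq> verts G"
    "\<And>u w. u \<in> V \<Longrightarrow> {u, w} \<in> edges G \<Longrightarrow> w \<in> V" by blast
  have VC: "V = connected_rel G `` {hd p}" using V(1) by (simp add: C_def induced_subgraph_def)
  have "set p \<subseteq> V"
    using path_connected_set[of G p "hd p" _ "verts G"] p hd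
    by (auto simp: VC connected_rel_eq is_path_def)
  then have pC: "is_path C p" using is_path_induced_subgraph[OF V(2)] V(1) p by simp
  have fC: "finite (verts C)" "simple_graph C"
    using fin V forest_induced_subgraph[OF fo V(2)] finite_subset
    by (auto simp: induced_subgraph_def forest_def)
  obtain x1 x2 x3 x4 x5 where pe: "p = [x1, x2, x3, x4, x5]"
    using p by (auto simp: numeral_eq_Suc length_Suc_conv)
  have "{x1, x2} \<in> edges C" "{x4, x5} \<in> edges C" "disjnt {x1, x2} {x4, x5}"
    using pC by (auto simp: pe is_path_def disjnt_def)
  then have "\<not> is_star C" using star_edges_intersect fC(2) by blast
  with C have "every_k_matching_extends C 2" by (simp add: internally_extendable_def)
  then have "P5_constrained C" by (rule extends_imp_P5_constrained[OF fC])
  then have "graph_degree C (p ! 2) \<ge> 3" using pC p by (auto simp: P5_constrained_def)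
  moreover have "p ! 2 \<in> V" using \<open>set p \<subseteq> V\<close> p by (simp add: subset_iff)
  then have "edges_at C (p ! 2) = edges_at G (p ! 2)"
    unfolding V(1) using edges_at_component[OF sg, of V "p ! 2"] V(3) by blast
  ultimately show "graph_degree G (p ! 2) \<ge> 3" by (simp add: graph_degree_def)
qed

text \<open>A component without two disjoint edges is a star. Otherwise it has a 2-matching, and
  being itself a P5-constrained forest it admits the extension of every 2-matching.\<close>

lemma P5_constrained_imp_components:
  assumes fin: "finite (verts G)" and fo: "forest G" and ni: "no_isolated_vertices G"
    and P5: "P5_constrained G" and C: "C \<in> graph_components G"
  shows "is_star C \<or> internally_extendable 2 C"
proof -
  have sg: "simple_graph G" using fo by (simp add: forest_def)
  obtain V where V: "C = induced_subgraph G V" "V \<subseteq> verts G" "V \<noteq> {}"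
    "\<And>u w. u \<in> V \<Longrightarrow> {u, w} \<in> edges G \<Longrightarrow> w \<in> V"
    "\<And>u w. u \<in> V \<Longrightarrow> w \<in> V \<Longrightarrow> (u, w) \<in> (adj G V)\<^sup>*"
    using graph_component_cases[OF sg C] by blast
  have vC: "verts C = V" by (simp add: V(1) induced_subgraph_def)
  have at: "edges_at C v = edges_at G v" if "v \<in> V" for v
    unfolding V(1) using edges_at_component[OF sg, of V v] V(4) that by blast
  have fC: "finite (verts C)" using fin V(2) vC finite_subset by blast
  have foC: "forest C" using forest_induced_subgraph[OF fo V(2)] V(1) by simp
  have niC: "no_isolated_vertices C" using ni at vC V(2) by (auto simp: no_isolated_vertices_def)
  show ?thesis
  proof (cases "\<exists>e\<in>edges C. \<exists>f\<in>edges C. disjnt e f")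
    case False
    then have "is_star C" using intersecting_edges_imp_star[OF fC foC niC] V(3) vC by blast
    then show ?thesis ..
  next
    case True
    then obtain e f where ef: "e \<in> edges C" "f \<in> edges C" "disjnt e f" by blast
    have sgC: "simple_graph C" using foC by (simp add: forest_def)
    have "e \<noteq> {}" using edge_cases[OF sgC ef(1)] by blast
    with ef have "e \<noteq> f" by (auto simp: disjnt_def)
    then have "k_matching C 2 {e, f}"
      using ef by (auto simp: k_matching_def matching_def pairwise_insert disjnt_sym)
    moreover have "connected_graph C"
      unfolding V(1) using V(3,5) by (rule connected_induced_subgraph)
    moreover have "P5_constrained C"
      unfolding P5_constrained_def
    proof (intro allI impI)
      fix p assume p: "is_path C p \<and> length p = 5"
      then have pG: "is_path G p" "set p \<subseteq> V"
        using is_path_induced_subgraph[OF V(2)] V(1) by auto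
      then have "p ! 2 \<in> V" using p by (simp add: subset_iff)
      then show "graph_degree C (p ! 2) \<ge> 3"
        using P5 pG(1) p at by (simp add: P5_constrained_def graph_degree_def)
    qed
    then have "every_k_matching_extends C 2" by (rule P5_constrained_imp_extends[OF fC foC niC])
    ultimately show ?thesis unfolding internally_extendable_def by blast
  qed
qed

theorem theorem5:
  fixes F :: "'a graph"
  assumes "finite (verts F)"
    and "forest F"
    and "no_isolated_vertices F"
  shows "((\<forall>C\<in>graph_components F. is_star C \<or> internally_extendable 2 C)
            \<longleftrightarrow> every_k_matching_extends F 2)
       \<and> (every_k_matching_extends F 2 \<longleftrightarrow> strongly_equistarable F)
       \<and> (strongly_equistarable F \<longleftrightarrow> equistarable F)
       \<and> (equistarable F \<longleftrightarrow> P5_constrained F)"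
proof -
  have sg: "simple_graph F" using assms(2) by (simp add: forest_def)
  have "(\<forall>C\<in>graph_components F. is_star C \<or> internally_extendable 2 C) \<longleftrightarrow> P5_constrained F"
    using components_imp_P5_constrained[OF assms(1,2)] P5_constrained_imp_components[OF assms] by blast
  moreover have "every_k_matching_extends F 2 \<longleftrightarrow> P5_constrained F"
    using extends_imp_P5_constrained[OF assms(1) sg] P5_constrained_imp_extends[OF assms] by blast
  moreover have "strongly_equistarable F \<longleftrightarrow> P5_constrained F"
    using strongly_equistarable_imp_P5_constrained[OF assms(1,2)]
      extends_imp_strongly_equistarable[OF assms] calculation(2) by blast
  moreover have "equistarable F \<longleftrightarrow> P5_constrained F"
    using equistarable_imp_P5_constrained[OF assms(1,2)]
      strongly_equistarable_imp_equistarable[OF assms(1) sg] calculation(3) by blast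
  ultimately show ?thesis by blast
qed

end
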